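(* Let $G$ be a directed partially ordered abelian group with the Riesz decomposition property and let $H$ be a Dedekind complete lattice-ordered abelian group. Then $\operatorname{A}_{\operatorname{b}}(G,H)$ is a Dedekind complete lattice-ordered abelian group.
   Context: A partially ordered abelian group is an abelian group with a translation invariant partial order; $G_+=\{x\in G;\ x\ge0\}$ and $[a,b]=\{z;\ a\le z\le b\}$. $G$ is directed if any two elements have a common upper bound. $G$ has the Riesz decomposition property if for all $x,y\in G_+$ and $w\in[0,x+y]$ there are $u\in[0,x]$, $v\in[0,y]$ with $w=u+v$. A partially ordered abelian group is lattice-ordered if it is a lattice; a lattice is Dedekind complete if every non-empty set bounded above has a supremum and every non-empty set bounded below has an infimum. $\operatorname{A}_{\operatorname{b}}(G,H)$ is the set of all order bounded additive maps (group homomorphisms mapping order bounded sets to order bounded sets) $G\to H$, with pointwise addition and the order $f\le g$ iff $f(x)\le g(x)$ for all $x\in G_+$; since $G$ is directed, this is a partially ordered abelian group. *)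

theory Defs
  imports Complex_Main "HOL-Library.Lub_Glb"
begin

text \<open>
  Partially ordered abelian groups are types of the library class
  \<^class>\<open>ordered_ab_group_add\<close>. The order-theoretic properties below are predicates on
  such types; they take a type argument, written \<open>TYPE('a)\<close>.
\<close>

class directed_ordered_ab_group_add = ordered_ab_group_add +
  assumes directed: "\<exists>z. x \<le> z \<and> y \<le> z"

definition riesz_decomposition :: "'a::ordered_ab_group_add itself \<Rightarrow> bool" where
  "riesz_decomposition _ \<longleftrightarrow>
    (\<forall>x\<ge>0. \<forall>y\<ge>0. \<forall>w\<in>{0..x + y :: 'a}. \<exists>u\<in>{0..x}. \<exists>v\<in>{0..y}. w = u + v)"

definition lattice_ordered :: "'a::ordered_ab_group_add itself \<Rightarrow> bool" where
  "lattice_ordered _ \<longleftrightarrow>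
    (\<forall>x y :: 'a. (\<exists>s. isLub UNIV {x, y} s) \<and> (\<exists>i. isGlb UNIV {x, y} i))"

definition dedekind_complete :: "'a::ordered_ab_group_add itself \<Rightarrow> bool" where
  "dedekind_complete _ \<longleftrightarrow>
    (\<forall>S :: 'a set. S \<noteq> {} \<and> bdd_above S \<longrightarrow> (\<exists>s. isLub UNIV S s)) \<and>
    (\<forall>S :: 'a set. S \<noteq> {} \<and> bdd_below S \<longrightarrow> (\<exists>i. isGlb UNIV S i))"

definition order_bounded :: "'a::order set \<Rightarrow> bool" where
  "order_bounded S \<longleftrightarrow> (\<exists>a b. S \<subseteq> {a..b})"

definition order_bounded_additive ::
    "('a::ordered_ab_group_add \<Rightarrow> 'b::ordered_ab_group_add) \<Rightarrow> bool" where
  "order_bounded_additive f \<longleftrightarrow>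
    additive f \<and> (\<forall>S. order_bounded S \<longrightarrow> order_bounded (f ` S))"

lemma order_bounded_additive_zero:
  "order_bounded_additive (\<lambda>_ :: 'a::ordered_ab_group_add. 0 :: 'b::ordered_ab_group_add)"
proof -
  have "(\<lambda>_. 0) ` S \<subseteq> {0..0 :: 'b}" for S :: "'a set"
    by auto
  then show ?thesis
    unfolding order_bounded_additive_def additive_def order_bounded_def
    by (metis add_0)
qed

lemma order_bounded_additive_add:
  assumes "order_bounded_additive f" "order_bounded_additive g"
  shows "order_bounded_additive (\<lambda>x. f x + g x)"
  unfolding order_bounded_additive_def
proof (intro conjI allI impI)
  show "additive (\<lambda>x. f x + g x)"
    using assms by (simp add: order_bounded_additive_def additive_def algebra_simps)
next
  fix S :: "'a set"
  assume "order_bounded S"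
  then obtain a b c d where "f ` S \<subseteq> {a..b}" "g ` S \<subseteq> {c..d}"
    using assms unfolding order_bounded_additive_def order_bounded_def by meson
  then have "(\<lambda>x. f x + g x) ` S \<subseteq> {a + c..b + d}"
    by (force intro: add_mono)
  then show "order_bounded ((\<lambda>x. f x + g x) ` S)"
    unfolding order_bounded_def by blast
qed

lemma order_bounded_additive_uminus:
  assumes "order_bounded_additive f"
  shows "order_bounded_additive (\<lambda>x. - f x)"
  unfolding order_bounded_additive_def
proof (intro conjI allI impI)
  show "additive (\<lambda>x. - f x)"
    using assms by (simp add: order_bounded_additive_def additive_def)
next
  fix S :: "'a set"
  assume "order_bounded S"
  then obtain a b where "f ` S \<subseteq> {a..b}"
    using assms unfolding order_bounded_additive_def order_bounded_def by meson
  then have "(\<lambda>x. - f x) ` S \<subseteq> {- b..- a}"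
    by force
  then show "order_bounded ((\<lambda>x. - f x) ` S)"
    unfolding order_bounded_def by blast
qed

typedef (overloaded) ('a, 'b) ob_additive_map =
    "{f :: 'a::directed_ordered_ab_group_add \<Rightarrow> 'b::ordered_ab_group_add. order_bounded_additive f}"
  morphisms apply_map Abs_map
  using order_bounded_additive_zero by blast

lemma apply_map_add: "apply_map f (x + y) = apply_map f x + apply_map f y"
  using apply_map[of f] by (simp add: order_bounded_additive_def additive_def)

lemma apply_map_diff: "apply_map f (x - y) = apply_map f x - apply_map f y"
  using apply_map_add[of f "x - y" y] by simp

lemma directed_diff_nonneg:
  fixes x :: "'a::directed_ordered_ab_group_add"
  obtains p q where "0 \<le> p" "0 \<le> q" "x = p - q"
proof -
  obtain z where "x \<le> z" "0 \<le> z"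
    using directed by blast
  then show thesis
    using that[of z "z - x"] by simp
qed

lemma map_eqI_nonneg:
  assumes "\<And>x. 0 \<le> x \<Longrightarrow> apply_map f x = apply_map g x"
  shows "f = g"
proof -
  have "apply_map f x = apply_map g x" for x
    by (rule directed_diff_nonneg[of x]) (simp add: apply_map_diff assms)
  then show ?thesis
    by (simp add: apply_map_inject[symmetric] ext)
qed

text \<open>
  The order compares maps on the positive cone only, so antisymmetry depends on the
  directedness of the domain.
\<close>

instantiation ob_additive_map ::
  (directed_ordered_ab_group_add, ordered_ab_group_add) ordered_ab_group_add
begin

definition "0 = Abs_map (\<lambda>_. 0)"
definition "f + g = Abs_map (\<lambda>x. apply_map f x + apply_map g x)"
definition "- f = Abs_map (\<lambda>x. - apply_map f x)"
definition "f - g = f + - (g :: ('a, 'b) ob_additive_map)"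
definition "f \<le> g \<longleftrightarrow> (\<forall>x\<ge>0. apply_map f x \<le> apply_map g x)"
definition "f < g \<longleftrightarrow> f \<le> g \<and> \<not> g \<le> (f :: ('a, 'b) ob_additive_map)"

lemma apply_map_zero: "apply_map 0 x = 0"
  by (simp add: zero_ob_additive_map_def Abs_map_inverse order_bounded_additive_zero)

lemma apply_map_plus: "apply_map (f + g) x = apply_map f x + apply_map g x"
  using apply_map[of f] apply_map[of g]
  by (simp add: plus_ob_additive_map_def Abs_map_inverse order_bounded_additive_add)

lemma apply_map_uminus: "apply_map (- f) x = - apply_map f x"
  using apply_map[of f]
  by (simp add: uminus_ob_additive_map_def Abs_map_inverse order_bounded_additive_uminus)

instance
proof
  fix f g h :: "('a, 'b) ob_additive_map"
  show "f + g + h = f + (g + h)" "f + g = g + f" "0 + f = f" "- f + f = 0"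
    by (rule map_eqI_nonneg, simp add: apply_map_plus apply_map_zero apply_map_uminus ac_simps)+
  show "f - g = f + - g"
    by (rule minus_ob_additive_map_def)
  show "f < g \<longleftrightarrow> f \<le> g \<and> \<not> g \<le> f"
    by (rule less_ob_additive_map_def)
  show "f \<le> f"
    by (simp add: less_eq_ob_additive_map_def)
  show "f \<le> h" if "f \<le> g" "g \<le> h"
    using that unfolding less_eq_ob_additive_map_def by (meson order_trans)
  show "f = g" if "f \<le> g" "g \<le> f"
    using that by (intro map_eqI_nonneg) (simp add: less_eq_ob_additive_map_def order_antisym)
  show "h + f \<le> h + g" if "f \<le> g"
    using that by (simp add: less_eq_ob_additive_map_def apply_map_plus)
qed

end

end

theory Submission
  imports Defs
begin

text \<open>
  A supremum of a set \<open>S\<close> of maps is given by the Riesz--Kantorovich formula: its value at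
  \<open>x \<ge> 0\<close> is the supremum of all sums \<open>f\<^sub>1 x\<^sub>1 + \<dots> + f\<^sub>n x\<^sub>n\<close> with \<open>f\<^sub>i \<in> S\<close>, \<open>x\<^sub>i \<ge> 0\<close>
  and \<open>x = x\<^sub>1 + \<dots> + x\<^sub>n\<close>. The Riesz decomposition property makes this additive on the positive
  cone, and additive maps on the cone extend to the whole directed group. The formula only requires
  these sums to be bounded above for each fixed \<open>x\<close>. This holds if \<open>S\<close> is bounded above, and also
  if \<open>S\<close> is a pair of order bounded maps, so both the lattice property and Dedekind
  completeness follow; infima are obtained by negation.
\<close>

lemma isLub_UNIV_iff:
  fixes s :: "'a::order"
  shows "isLub UNIV S s \<longleftrightarrow> (\<forall>x\<in>S. x \<le> s) \<and> (\<forall>t. (\<forall>x\<in>S. x \<le> t) \<longrightarrow> s \<le> t)"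
  by (auto simp: isLub_def leastP_def isUb_def setle_def setge_def)

lemma isGlb_UNIV_iff:
  fixes s :: "'a::order"
  shows "isGlb UNIV S s \<longleftrightarrow> (\<forall>x\<in>S. s \<le> x) \<and> (\<forall>t. (\<forall>x\<in>S. t \<le> x) \<longrightarrow> t \<le> s)"
  by (auto simp: isGlb_def greatestP_def isLb_def setle_def setge_def)

lemma isGlb_uminus:
  fixes s :: "'a::ordered_ab_group_add"
  assumes "isLub UNIV (uminus ` S) s"
  shows "isGlb UNIV S (- s)"
  unfolding isGlb_UNIV_iff
proof (intro conjI ballI allI impI)
  show "- s \<le> x" if "x \<in> S" for x
    using assms that by (auto simp: isLub_UNIV_iff minus_le_iff[of s])
  show "t \<le> - s" if "\<forall>x\<in>S. t \<le> x" for t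
    using assms that by (simp add: isLub_UNIV_iff le_minus_iff[of t s])
qed

text \<open>If \<open>t\<close> bounds all sums, then \<open>t - y\<close> bounds \<open>A\<close>
  for each \<open>y\<close> in \<open>B\<close>, so \<open>a \<le> t - y\<close>; hence
  \<open>t - a\<close> bounds \<open>B\<close>. This turns splitting of decomposition sums into
  additivity of the Riesz--Kantorovich supremum.\<close>

lemma isLub_add:
  fixes a b :: "'a::ordered_ab_group_add"
  assumes a: "isLub UNIV A a" and b: "isLub UNIV B b"
  shows "isLub UNIV {x + y |x y. x \<in> A \<and> y \<in> B} (a + b)"
  unfolding isLub_UNIV_iff
proof (intro conjI ballI allI impI)
  show "z \<le> a + b" if "z \<in> {x + y |x y. x \<in> A \<and> y \<in> B}" for z
    using a b that by (auto simp: isLub_UNIV_iff intro: add_mono)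
next
  fix t
  assume t: "\<forall>z\<in>{x + y |x y. x \<in> A \<and> y \<in> B}. z \<le> t"
  have "a \<le> t - y" if "y \<in> B" for y
  proof -
    have "\<forall>x\<in>A. x \<le> t - y"
      using t that by (auto simp: le_diff_eq)
    then show ?thesis
      using a by (simp add: isLub_UNIV_iff)
  qed
  then have "\<forall>y\<in>B. y \<le> t - a"
    by (simp add: le_diff_eq add.commute)
  then have "b \<le> t - a"
    using b by (simp add: isLub_UNIV_iff)
  then show "a + b \<le> t"
    by (simp add: le_diff_eq add.commute)
qed

lemma isLub_unique_UNIV:
  fixes a b :: "'a::order"
  shows "isLub UNIV A a \<Longrightarrow> isLub UNIV A b \<Longrightarrow> a = b"
  by (simp add: isLub_UNIV_iff order_antisym)

text \<open>By directedness every element is a difference \<open>p - q\<close> of positive ones,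
  which forces the value \<open>s p - s q\<close>. Two representations agree because
  \<open>p - q = p' - q'\<close> becomes \<open>p + q' = p' + q\<close>, an equation inside the
  cone, where \<open>s\<close> is additive.\<close>

lemma additive_extension:
  fixes s :: "'a::directed_ordered_ab_group_add \<Rightarrow> 'b::ab_group_add"
  assumes s: "\<And>x y. 0 \<le> x \<Longrightarrow> 0 \<le> y \<Longrightarrow> s (x + y) = s x + s y"
  obtains F where "additive F" "\<And>x. 0 \<le> x \<Longrightarrow> F x = s x"
proof -
  have "\<exists>v. \<forall>p q. 0 \<le> p \<and> 0 \<le> q \<and> x = p - q \<longrightarrow> v = s p - s q" for x
  proof -
    obtain p q where pq: "0 \<le> p" "0 \<le> q" "x = p - q"
      by (rule directed_diff_nonneg)
    have "s p - s q = s p' - s q'" if "0 \<le> p'" "0 \<le> q'" "x = p' - q'" for p' q'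
    proof -
      have "p + q' = p' + q"
        using pq that by (simp add: algebra_simps)
      then have "s p + s q' = s p' + s q"
        using pq that by (simp flip: s)
      then show ?thesis
        by (simp add: algebra_simps)
    qed
    then show ?thesis
      by blast
  qed
  then obtain F where F: "\<And>p q. 0 \<le> p \<Longrightarrow> 0 \<le> q \<Longrightarrow> F (p - q) = s p - s q"
    by metis
  have "F (x + y) = F x + F y" for x y
  proof -
    obtain p q where pq: "0 \<le> p" "0 \<le> q" "x = p - q"
      by (rule directed_diff_nonneg)
    obtain p' q' where pq': "0 \<le> p'" "0 \<le> q'" "y = p' - q'"
      by (rule directed_diff_nonneg)
    have "x + y = (p + p') - (q + q')"
      using pq pq' by simp
    then show ?thesis
      using pq pq' F[of "p + p'" "q + q'"] F[of p q] F[of p' q']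
      by (simp only: s add_nonneg_nonneg add_diff_add)
  qed
  then have "additive F"
    by (simp add: additive_def)
  moreover have "F x = s x" if "0 \<le> x" for x
    \<comment> \<open>Additivity at \<open>0\<close> gives \<open>s 0 = 0\<close>, so the
      representation \<open>x - 0\<close> has value \<open>s x\<close>.\<close>
    using F[of x 0] s[of 0 0] that by simp
  ultimately show thesis
    by (rule that)
qed

text \<open>Translation by \<open>- a\<close> carries \<open>{a..b}\<close> to
  \<open>{0..b - a}\<close> and changes the values of an additive map only by the constant
  \<open>F a\<close>.\<close>

lemma order_bounded_additiveI:
  fixes F :: "'a::ordered_ab_group_add \<Rightarrow> 'b::ordered_ab_group_add"
  assumes F: "additive F"
    and bounded: "\<And>x. 0 \<le> x \<Longrightarrow> order_bounded (F ` {0..x})"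
  shows "order_bounded_additive F"
  unfolding order_bounded_additive_def
proof (intro conjI allI impI)
  fix S :: "'a set"
  assume "order_bounded S"
  then obtain a b where S: "S \<subseteq> {a..b}"
    by (auto simp: order_bounded_def)
  show "order_bounded (F ` S)"
  proof (cases "a \<le> b")
    case True
    then obtain c d where cd: "F ` {0..b - a} \<subseteq> {c..d}"
      using bounded[of "b - a"] by (auto simp: order_bounded_def)
    have "F z \<in> {c + F a..d + F a}" if "z \<in> S" for z
    proof -
      have "z - a \<in> {0..b - a}"
        using S that by auto
      then have "F (z - a) \<in> {c..d}"
        using cd by blast
      then show ?thesis
        by (simp add: additive.diff[OF F] algebra_simps)
    qed
    then have "F ` S \<subseteq> {c + F a..d + F a}"
      by blast
    then show ?thesis
      unfolding order_bounded_def by blast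
  next
    \<comment> \<open>Here \<open>{a..b}\<close> is empty, hence so is \<open>S\<close>.\<close>
    case False
    then show ?thesis
      using S by (auto simp: order_bounded_def)
  qed
qed (rule F)

text \<open>The finite sums of the Riesz--Kantorovich formula, generated by binary addition instead
  of indexed families. The rule \<open>add\<close> is already one half of the additivity in
  \<open>x\<close>.\<close>

inductive decomposition_sum ::
    "('a::directed_ordered_ab_group_add, 'b::ordered_ab_group_add) ob_additive_map set
      \<Rightarrow> 'a \<Rightarrow> 'b \<Rightarrow> bool" for S where
  single: "f \<in> S \<Longrightarrow> 0 \<le> x \<Longrightarrow> decomposition_sum S x (apply_map f x)"
| add: "decomposition_sum S x a \<Longrightarrow> decomposition_sum S y b
    \<Longrightarrow> decomposition_sum S (x + y) (a + b)"

lemma decomposition_sum_nonneg: "decomposition_sum S x c \<Longrightarrow> 0 \<le> x"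
  by (induction rule: decomposition_sum.induct) auto

text \<open>Replacing every map in the sum by \<open>h\<close> can only increase it, and additivity
  of \<open>h\<close> collapses the result to \<open>apply_map h x\<close>.\<close>

lemma decomposition_sum_le:
  assumes "decomposition_sum S x c" and "\<And>f. f \<in> S \<Longrightarrow> f \<le> h"
  shows "c \<le> apply_map h x"
  using assms
  by (induction rule: decomposition_sum.induct)
    (auto simp: less_eq_ob_additive_map_def apply_map_add intro: add_mono)

text \<open>The converse of the rule \<open>add\<close>: Riesz decomposition refines the partition
  behind the sum so that each piece is cut into a part for \<open>x\<close> and a part for
  \<open>y\<close>.\<close>

lemma decomposition_sum_split:
  fixes S :: "('a::directed_ordered_ab_group_add, 'b::ordered_ab_group_add) ob_additive_map set"
  assumes riesz: "riesz_decomposition TYPE('a)"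
    and "decomposition_sum S (x + y) c" "0 \<le> x" "0 \<le> y"
  shows "\<exists>a b. c = a + b \<and> decomposition_sum S x a \<and> decomposition_sum S y b"
  using assms(2-)
proof (induction "x + y" c arbitrary: x y rule: decomposition_sum.induct)
  case (single f)
  then have "decomposition_sum S x (apply_map f x)" "decomposition_sum S y (apply_map f y)"
    by (auto intro: decomposition_sum.single)
  then show ?case
    using apply_map_add by blast
next
  case (add z a w b)
  have "0 \<le> z" "0 \<le> w"
    using add.hyps(1,3) by (simp_all add: decomposition_sum_nonneg)
  then have "z \<in> {0..x + y}"
    using add.hyps(5) by (metis atLeastAtMost_iff le_add_same_cancel1)
  then obtain u v where uv: "u \<in> {0..x}" "v \<in> {0..y}" "z = u + v"
    using riesz add.prems unfolding riesz_decomposition_def by blast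
  \<comment> \<open>What \<open>u\<close> and \<open>v\<close> leave over of \<open>x\<close> and
    \<open>y\<close> is a splitting of \<open>w\<close> into positive parts, as the second induction
    hypothesis needs.\<close>
  have w: "w = (x - u) + (y - v)"
    using uv add.hyps(5) by (simp add: algebra_simps)
  obtain a1 a2 where 1: "decomposition_sum S u a1" "decomposition_sum S v a2" "a = a1 + a2"
    using add.hyps(2)[of u v] uv by auto
  obtain b1 b2 where 2: "decomposition_sum S (x - u) b1" "decomposition_sum S (y - v) b2"
    "b = b1 + b2"
    using add.hyps(4)[of "x - u" "y - v"] uv w by auto
  have "decomposition_sum S x (a1 + b1)"
    using decomposition_sum.add[OF 1(1) 2(1)] by simp
  moreover have "decomposition_sum S y (a2 + b2)"
    using decomposition_sum.add[OF 1(2) 2(2)] by simp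
  moreover have "a + b = (a1 + b1) + (a2 + b2)"
    using 1 2 by (simp add: algebra_simps)
  ultimately show ?case
    by blast
qed

text \<open>Collecting all arguments of \<open>f\<close> into \<open>u\<close> leaves
  \<open>x - u\<close> for \<open>g\<close>. The sums for a pair are thus controlled by the values
  of \<open>f\<close> and \<open>g\<close> on the single interval \<open>{0..x}\<close>.\<close>

lemma decomposition_sum_pair:
  assumes "decomposition_sum {f, g} x c"
  shows "\<exists>u\<in>{0..x}. c = apply_map f u + apply_map g (x - u)"
  using assms
proof (induction rule: decomposition_sum.induct)
  case (single k x)
  have "apply_map k 0 = 0" for k :: "('a, 'b) ob_additive_map"
    using apply_map_diff[of k 0 0] by simp
  then show ?case
    \<comment> \<open>The witness is \<open>x\<close> if \<open>k\<close> is \<open>f\<close>, and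
      \<open>0\<close> if \<open>k\<close> is \<open>g\<close>.\<close>
    using single by (auto intro: bexI[of _ 0] bexI[of _ x])
next
  case (add x a y b)
  then obtain u v where "u \<in> {0..x}" "a = apply_map f u + apply_map g (x - u)"
    "v \<in> {0..y}" "b = apply_map f v + apply_map g (y - v)"
    by blast
  then show ?case
    by (intro bexI[of _ "u + v"]) (auto simp: apply_map_add apply_map_diff add_mono)
qed

lemma isLub_ob_additive_map:
  fixes S :: "('a::directed_ordered_ab_group_add, 'b::ordered_ab_group_add) ob_additive_map set"
  assumes riesz: "riesz_decomposition TYPE('a)"
    and complete: "dedekind_complete TYPE('b)"
    and "S \<noteq> {}"
    and bdd: "\<And>x. 0 \<le> x \<Longrightarrow> bdd_above {c. decomposition_sum S x c}"
  shows "\<exists>s. isLub UNIV S s"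
proof -
  obtain f where f: "f \<in> S"
    using \<open>S \<noteq> {}\<close> by blast
  \<comment> \<open>The implication lets a total function \<open>s\<close> be chosen, with arbitrary
    values off the cone.\<close>
  have "\<exists>l. 0 \<le> x \<longrightarrow> isLub UNIV {c. decomposition_sum S x c} l" for x
  proof (cases "0 \<le> x")
    case True
    then have "{c. decomposition_sum S x c} \<noteq> {}"
      using f decomposition_sum.single by blast
    then show ?thesis
      using complete bdd[OF True] by (simp add: dedekind_complete_def)
  qed simp
  then obtain s where s: "\<And>x. 0 \<le> x \<Longrightarrow> isLub UNIV {c. decomposition_sum S x c} (s x)"
    by metis
  have "s (x + y) = s x + s y" if "0 \<le> x" "0 \<le> y" for x y
  proof -
    have "{c. decomposition_sum S (x + y) c} =
        {a + b |a b. a \<in> {c. decomposition_sum S x c} \<and> b \<in> {c. decomposition_sum S y c}}"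
      by (auto dest: decomposition_sum_split[OF riesz _ that] intro: decomposition_sum.add)
    then have "isLub UNIV {c. decomposition_sum S (x + y) c} (s x + s y)"
      using isLub_add[OF s[OF that(1)] s[OF that(2)]] by simp
    then show ?thesis
      using s[of "x + y"] that by (simp add: isLub_unique_UNIV)
  qed
  then obtain F where F: "additive F" "\<And>x. 0 \<le> x \<Longrightarrow> F x = s x"
    using additive_extension by blast
  have ge: "apply_map k x \<le> F x" if "k \<in> S" "0 \<le> x" for k x
    using s[OF that(2)] that by (auto simp: isLub_UNIV_iff F intro: decomposition_sum.single)
  have "order_bounded (F ` {0..x})" if "0 \<le> x" for x
  proof -
    have "order_bounded {0..x}"
      by (auto simp: order_bounded_def)
    then obtain a b where ab: "apply_map f ` {0..x} \<subseteq> {a..b}"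
      using apply_map[of f] unfolding order_bounded_additive_def order_bounded_def by blast
    \<comment> \<open>The member \<open>f\<close> of \<open>S\<close> lies below \<open>F\<close> on
      the cone and above \<open>a\<close> on \<open>{0..x}\<close>, which gives the lower bound. The
      upper bound comes from the reflected point:
      \<open>F x - F u = F (x - u) \<ge> a\<close>.\<close>
    have "F u \<in> {a..F x - a}" if "u \<in> {0..x}" for u
    proof -
      have "u \<in> {0..x}" "x - u \<in> {0..x}"
        using that by auto
      then have "a \<le> apply_map f u" "a \<le> apply_map f (x - u)"
        using ab by (meson atLeastAtMost_iff imageI subsetD)+
      moreover have "apply_map f u \<le> F u" "apply_map f (x - u) \<le> F (x - u)"
        using ge[OF f] that by auto
      ultimately have "a \<le> F u" "a \<le> F x - F u"
        by (auto simp: additive.diff[OF F(1)] intro: order_trans)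
      then show ?thesis
        by (simp add: le_diff_eq add.commute)
    qed
    then have "F ` {0..x} \<subseteq> {a..F x - a}"
      by blast
    then show ?thesis
      unfolding order_bounded_def by blast
  qed
  then have "order_bounded_additive F"
    by (rule order_bounded_additiveI[OF F(1)])
  then have apply_F: "apply_map (Abs_map F) = F"
    by (simp add: Abs_map_inverse)
  have "isLub UNIV S (Abs_map F)"
    unfolding isLub_UNIV_iff
  proof (intro conjI ballI allI impI)
    show "k \<le> Abs_map F" if "k \<in> S" for k
      using ge[OF that] by (simp add: less_eq_ob_additive_map_def apply_F)
    \<comment> \<open>An upper bound \<open>h\<close> dominates every decomposition sum at
      \<open>x\<close>, hence also their supremum \<open>s x\<close>.\<close>
    show "Abs_map F \<le> h" if "\<forall>k\<in>S. k \<le> h" for h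
      using s that decomposition_sum_le
      by (fastforce simp: less_eq_ob_additive_map_def apply_F F isLub_UNIV_iff)
  qed
  then show ?thesis
    by blast
qed

theorem theorem6p3:
  assumes "riesz_decomposition TYPE('a::directed_ordered_ab_group_add)"
    and "lattice_ordered TYPE('b::ordered_ab_group_add)"
    and "dedekind_complete TYPE('b)"
  shows "lattice_ordered TYPE(('a, 'b) ob_additive_map)
    \<and> dedekind_complete TYPE(('a, 'b) ob_additive_map)"
proof
  note lub = isLub_ob_additive_map[OF assms(1,3)]
  have pair: "\<exists>s. isLub UNIV {f, g} s" for f g :: "('a, 'b) ob_additive_map"
  proof (rule lub)
    fix x :: 'a
    assume "0 \<le> x"
    \<comment> \<open>Order boundedness of \<open>f\<close> and \<open>g\<close> replaces a common
      upper bound: both \<open>u\<close> and \<open>x - u\<close> stay in \<open>{0..x}\<close>, so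
      each sum for the pair is at most \<open>b + c\<close>.\<close>
    have "\<exists>b. \<forall>u\<in>{0..x}. apply_map k u \<le> b" for k :: "('a, 'b) ob_additive_map"
    proof -
      have "order_bounded {0..x}"
        by (auto simp: order_bounded_def)
      then have "order_bounded (apply_map k ` {0..x})"
        using apply_map[of k] by (simp add: order_bounded_additive_def)
      then show ?thesis
        by (force simp: order_bounded_def)
    qed
    then obtain b c where b: "\<forall>u\<in>{0..x}. apply_map f u \<le> b"
      and c: "\<forall>u\<in>{0..x}. apply_map g u \<le> c"
      by meson
    show "bdd_above {c. decomposition_sum {f, g} x c}"
      by (rule bdd_aboveI[of _ "b + c"])
        (use b c in \<open>auto dest!: decomposition_sum_pair intro!: add_mono\<close>)
  qed simp
  show "lattice_ordered TYPE(('a, 'b) ob_additive_map)"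
    unfolding lattice_ordered_def
  proof (intro allI conjI)
    fix f g :: "('a, 'b) ob_additive_map"
    show "\<exists>s. isLub UNIV {f, g} s"
      by (rule pair)
    show "\<exists>i. isGlb UNIV {f, g} i"
      using pair[of "- f" "- g"] isGlb_uminus[of "{f, g}"] by auto
  qed
  have bounded: "\<exists>s. isLub UNIV S s" if "S \<noteq> {}" "bdd_above S"
    for S :: "('a, 'b) ob_additive_map set"
  proof (rule lub[OF \<open>S \<noteq> {}\<close>])
    obtain h where "\<And>f. f \<in> S \<Longrightarrow> f \<le> h"
      using \<open>bdd_above S\<close> by (auto simp: bdd_above_def)
    then show "bdd_above {c. decomposition_sum S x c}" for x
      by (intro bdd_aboveI[of _ "apply_map h x"]) (auto intro: decomposition_sum_le)
  qed
  show "dedekind_complete TYPE(('a, 'b) ob_additive_map)"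
    unfolding dedekind_complete_def
  proof (intro allI conjI impI; elim conjE)
    fix S :: "('a, 'b) ob_additive_map set"
    assume S: "S \<noteq> {}"
    show "\<exists>s. isLub UNIV S s" if "bdd_above S"
      using bounded S that .
    show "\<exists>i. isGlb UNIV S i" if "bdd_below S"
    proof -
      obtain h where "\<And>f. f \<in> S \<Longrightarrow> h \<le> f"
        using \<open>bdd_below S\<close> by (auto simp: bdd_below_def)
      \<comment> \<open>Negation reverses the order, so the supremum of the negated set yields the
        infimum of \<open>S\<close>.\<close>
      then have "bdd_above (uminus ` S)"
        by (intro bdd_aboveI[of _ "- h"]) auto
      then show ?thesis
        using bounded[of "uminus ` S"] S isGlb_uminus by blast
    qed
  qed
qed

end
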